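(* Let $t\ge1$, $\alpha>0$, $\mathbf{h}=[h_1\cdots h_t]^T\sim\mathrm{CN}(\mathbf{I}_t)$, and $\mathbf{h}_i=[h_1\cdots h_i]^T$. For an integer $\ell\ge0$ and $x\in[-1,1]$ let $q(x;\ell)=\mathrm{sign}(x)\,2^{-(\ell+1)}\lfloor |x|2^{\ell+1}\rfloor$, and for $\mathbf{x}\in\mathbb{C}^i$ with $\|\mathbf{x}\|\le1$ let $q(\mathbf{x};\ell)$ be the vector whose $k$-th entry is $q(\Re x_k;\ell)+\mathrm{j}\,q(\Im x_k;\ell)$. For $\|\mathbf{h}_i\|^2>\alpha$ let $L(\mathbf{h}_i)=\max\{\lceil\log_2(4i)\rceil,\lceil\log_2\frac{4i\alpha}{\|\mathbf{h}_i\|^2-\alpha}\rceil\}$ and $\mathtt{C}_i(\mathbf{h}_i)=q(\mathbf{h}_i/\|\mathbf{h}_i\|;L(\mathbf{h}_i))\in\mathbb{C}^i$. Scheme $\mathtt{D}$ operates as follows: starting with $i=1$, the transmitter trains antenna $i$ (the receiver learns $h_i$, hence $\mathbf{h}_i$). If $\|\mathbf{h}_i\|^2\le\alpha$, the receiver feeds back the single bit $\mathtt{0}$; then if $i<t$ set $i\leftarrow i+1$ and repeat, while if $i=t$ the transmitter transmits with $\mathbf{e}_1$. If $\|\mathbf{h}_i\|^2>\alpha$, the receiver feeds back a codeword of $2i(L(\mathbf{h}_i)+3)$ bits describing $\mathtt{C}_i(\mathbf{h}_i)$, and the transmitter transmits with the beamforming vector $[\mathtt{C}_i(\mathbf{h}_i)^T\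 \mathbf{0}_{1\times(t-i)}]^T$. Then $\mathtt{out}(\mathtt{D})=\mathtt{out}(\mathtt{F})=\mathrm{P}(\|\mathbf{h}\|^2<\alpha)$, $\mathtt{tl}(\mathtt{D})\le 1+\alpha$, and $\mathtt{fr}(\mathtt{D})\le 92(1+\alpha^3)$.
   Context: $\mathbf{e}_1$ is the first standard basis vector of $\mathbb{C}^t$; $\mathrm{j}=\sqrt{-1}$. For a scheme transmitting with beamforming vector $\mathbf{x}(\mathbf{h})$ ($\|\mathbf{x}\|\le1$), the outage probability is $\mathtt{out}=\mathrm{P}(|\langle\mathbf{x}(\mathbf{h}),\mathbf{h}\rangle|^2<\alpha)$ with $\langle\mathbf{x},\mathbf{h}\rangle=\sum_k\overline{x_k}h_k$; $\mathtt{out}(\mathtt{F})=\mathrm{P}(\|\mathbf{h}\|^2<\alpha)$ is the outage probability with perfect channel knowledge (beamforming along $\mathbf{h}/\|\mathbf{h}\|$). The training length $\mathtt{tl}$ is the expected number of antennas trained per channel state, and the feedback rate $\mathtt{fr}$ is the expected total number of feedback bits per channel state (counting each one-bit $\mathtt{0}$ message and the final codeword). $\mathrm{CN}(\mathbf{I}_t)$: i.i.d. standard circularly-symmetric complex Gaussian entries. *)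

theory Defs
  imports "HOL-Probability.Probability"
begin

(* Channel vectors h = [h_1 ... h_t]^T are functions nat => complex; only the
   entries with index in {1..t} are meaningful. *)

definition CN_std :: "complex measure" where
  "CN_std = density lborel (\<lambda>z. ennreal (exp (- (cmod z)\<^sup>2) / pi))"

definition chan :: "nat \<Rightarrow> (nat \<Rightarrow> complex) measure" where
  "chan t = PiM {1..t} (\<lambda>_. CN_std)"

definition prefix_normsq :: "(nat \<Rightarrow> complex) \<Rightarrow> nat \<Rightarrow> real" where
  "prefix_normsq h i = (\<Sum>k=1..i. (cmod (h k))\<^sup>2)"

definition cinner :: "nat \<Rightarrow> (nat \<Rightarrow> complex) \<Rightarrow> (nat \<Rightarrow> complex) \<Rightarrow> complex" where
  "cinner t x h = (\<Sum>k=1..t. cnj (x k) * h k)"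

definition quant :: "real \<Rightarrow> nat \<Rightarrow> real" where
  "quant x l = sgn x * (1 / 2 ^ (l + 1)) * of_int \<lfloor>\<bar>x\<bar> * 2 ^ (l + 1)\<rfloor>"

definition quant_vec :: "(nat \<Rightarrow> complex) \<Rightarrow> nat \<Rightarrow> (nat \<Rightarrow> complex)" where
  "quant_vec x l = (\<lambda>k. Complex (quant (Re (x k)) l) (quant (Im (x k)) l))"

definition Lq :: "real \<Rightarrow> (nat \<Rightarrow> complex) \<Rightarrow> nat \<Rightarrow> nat" where
  "Lq \<alpha> h i = nat (max \<lceil>log 2 (4 * real i)\<rceil>
                        \<lceil>log 2 (4 * real i * \<alpha> / (prefix_normsq h i - \<alpha>))\<rceil>)"

definition Ci :: "real \<Rightarrow> (nat \<Rightarrow> complex) \<Rightarrow> nat \<Rightarrow> (nat \<Rightarrow> complex)" where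
  "Ci \<alpha> h i = quant_vec (\<lambda>k. h k / complex_of_real (sqrt (prefix_normsq h i))) (Lq \<alpha> h i)"

definition D_stop :: "real \<Rightarrow> nat \<Rightarrow> (nat \<Rightarrow> complex) \<Rightarrow> nat option" where
  "D_stop \<alpha> t h =
     (if \<exists>i\<in>{1..t}. prefix_normsq h i > \<alpha>
      then Some (LEAST i. i \<in> {1..t} \<and> prefix_normsq h i > \<alpha>) else None)"

definition D_beam :: "real \<Rightarrow> nat \<Rightarrow> (nat \<Rightarrow> complex) \<Rightarrow> (nat \<Rightarrow> complex)" where
  "D_beam \<alpha> t h =
     (case D_stop \<alpha> t h of
        None \<Rightarrow> (\<lambda>k. if k = 1 then 1 else 0)
      | Some i \<Rightarrow> (\<lambda>k. if 1 \<le> k \<and> k \<le> i then Ci \<alpha> h i k else 0))"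

definition D_trained :: "real \<Rightarrow> nat \<Rightarrow> (nat \<Rightarrow> complex) \<Rightarrow> nat" where
  "D_trained \<alpha> t h = (case D_stop \<alpha> t h of None \<Rightarrow> t | Some i \<Rightarrow> i)"

(* total number of feedback bits of scheme D in channel state h:
   one bit 0 per antenna i with ||h_i||^2 <= alpha, plus the final codeword *)
definition D_bits :: "real \<Rightarrow> nat \<Rightarrow> (nat \<Rightarrow> complex) \<Rightarrow> nat" where
  "D_bits \<alpha> t h = (case D_stop \<alpha> t h of None \<Rightarrow> t
                      | Some i \<Rightarrow> (i - 1) + 2 * i * (Lq \<alpha> h i + 3))"

definition outage :: "nat \<Rightarrow> real \<Rightarrow> ((nat \<Rightarrow> complex) \<Rightarrow> (nat \<Rightarrow> complex)) \<Rightarrow> real" where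
  "outage t \<alpha> x =
     measure (chan t) {h \<in> space (chan t). (cmod (cinner t (x h) h))\<^sup>2 < \<alpha>}"

definition outage_F :: "nat \<Rightarrow> real \<Rightarrow> real" where
  "outage_F t \<alpha> = measure (chan t) {h \<in> space (chan t). prefix_normsq h t < \<alpha>}"

definition tl_D :: "real \<Rightarrow> nat \<Rightarrow> ennreal" where
  "tl_D \<alpha> t = (\<integral>\<^sup>+ h. ennreal (real (D_trained \<alpha> t h)) \<partial>chan t)"

definition fr_D :: "real \<Rightarrow> nat \<Rightarrow> ennreal" where
  "fr_D \<alpha> t = (\<integral>\<^sup>+ h. ennreal (real (D_bits \<alpha> t h)) \<partial>chan t)"

end

theory Submission
  imports Defs "HOL-Real_Asymp.Real_Asymp"
begin

text \<open>The partial energies \<open>\<parallel>\<^bold>h\<^sub>i\<parallel>\<^sup>2\<close> are Erlang distributed with \<open>i\<close> stages and rate 1.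
  Quantization at resolution \<open>L\<close> loses at most the surplus \<open>\<parallel>\<^bold>h\<^sub>i\<parallel>\<^sup>2 - \<alpha>\<close> in received energy, so
  scheme D is in outage only if no prefix exceeds \<open>\<alpha>\<close>; this differs from full knowledge only on the
  null event \<open>\<parallel>\<^bold>h\<parallel>\<^sup>2 = \<alpha>\<close>. Both rates are dominated pointwise by sums over \<open>i\<close> of functions of
  \<open>\<parallel>\<^bold>h\<^sub>i\<parallel>\<^sup>2\<close> alone. Since the Erlang densities at \<open>x\<close> are the Poisson weights of mean \<open>x\<close>,
  exchanging sum and integral leaves Poisson moments, polynomial in \<open>x\<close>, to be integrated over
  \<open>[0, \<alpha>]\<close>, and a logarithmic overshoot term over \<open>(\<alpha>, 2\<alpha>]\<close>.\<close>

section \<open>The distribution of the prefix energies\<close>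

text \<open>Last integral in the Gaussian tail computation below: \<open>s - a\<close> is the area,
  divided by \<open>pi\<close>, of the annulus between squared radii \<open>a\<close> and
  \<open>s\<close>.\<close>

lemma nn_integral_shifted_exp_tail:
  fixes a :: real
  shows "(\<integral>\<^sup>+s. ennreal ((s - a) * exp (- s)) * indicator {a..} s \<partial>lborel) = ennreal (exp (- a))"
proof -
  have "(\<integral>\<^sup>+s. ennreal ((s - a) * exp (- s)) * indicator {a..} s \<partial>lborel)
        = ennreal (0 - (\<lambda>s. - (s - a + 1) * exp (- s)) a)"
  proof (rule nn_integral_FTC_atLeast[where F = "\<lambda>s. - (s - a + 1) * exp (- s)"])
    show "((\<lambda>s. - (s - a + 1) * exp (- s)) \<longlongrightarrow> 0) at_top"
      by real_asymp
    show "DERIV (\<lambda>s. - (s - a + 1) * exp (- s)) x :> (x - a) * exp (- x)" for x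
      by (auto intro!: derivative_eq_intros simp: algebra_simps)
  qed (auto intro!: derivative_eq_intros simp: algebra_simps)
  then show ?thesis by simp
qed

lemma nn_integral_exp_tail:
  fixes a :: real
  shows "(\<integral>\<^sup>+s. ennreal (exp (- s)) * indicator {a..} s \<partial>lborel) = ennreal (exp (- a))"
proof -
  have "(\<integral>\<^sup>+s. ennreal (exp (- s)) * indicator {a..} s \<partial>lborel)
        = ennreal (0 - (\<lambda>s. - exp (- s)) a)"
  proof (rule nn_integral_FTC_atLeast)
    show "((\<lambda>s::real. - exp (- s)) \<longlongrightarrow> 0) at_top"
      by real_asymp
  qed (auto intro!: derivative_eq_intros)
  then show ?thesis by simp
qed

lemma emeasure_disc:
  assumes "0 \<le> s"
  shows "emeasure lborel {z :: complex. (cmod z)\<^sup>2 \<le> s} = ennreal (pi * s)"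
proof -
  have "{z :: complex. (cmod z)\<^sup>2 \<le> s} = cball 0 (sqrt s)"
    using assms by (auto simp: real_le_rsqrt) (metis norm_ge_zero power_mono real_sqrt_pow2)
  then show ?thesis
    using assms by (simp add: emeasure_cball unit_ball_vol_2)
qed

lemma emeasure_annulus:
  assumes "0 \<le> a" "a \<le> s"
  shows "emeasure lborel {z :: complex. a < (cmod z)\<^sup>2 \<and> (cmod z)\<^sup>2 \<le> s} = ennreal (pi * (s - a))"
proof -
  have "{z :: complex. a < (cmod z)\<^sup>2 \<and> (cmod z)\<^sup>2 \<le> s}
        = {z. (cmod z)\<^sup>2 \<le> s} - {z. (cmod z)\<^sup>2 \<le> a}" by auto
  also have "emeasure lborel \<dots> = ennreal (pi * s) - ennreal (pi * a)"
    using assms by (subst emeasure_Diff) (auto simp: emeasure_disc)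
  also have "\<dots> = ennreal (pi * (s - a))"
    using assms by (simp add: ennreal_minus algebra_simps)
  finally show ?thesis .
qed

lemma sets_CN_std [measurable_cong]: "sets CN_std = sets borel"
  by (simp add: CN_std_def)

lemma space_CN_std [simp]: "space CN_std = UNIV"
  by (simp add: CN_std_def)

text \<open>Writing \<^term>\<open>exp (- (cmod z)\<^sup>2)\<close> as the integral of \<^term>\<open>exp (- s)\<close> over
  \<open>s \<ge> (cmod z)\<^sup>2\<close> and exchanging integrals reduces the Gaussian integral to areas of annuli.\<close>

lemma emeasure_CN_std_tail:
  assumes "0 \<le> a"
  shows "emeasure CN_std {z. a < (cmod z)\<^sup>2} = ennreal (exp (- a))"
proof -
  have "emeasure CN_std {z. a < (cmod z)\<^sup>2}
      = (\<integral>\<^sup>+z. ennreal (exp (- (cmod z)\<^sup>2) / pi) * indicator {z. a < (cmod z)\<^sup>2} z \<partial>lborel)"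
    unfolding CN_std_def by (subst emeasure_density) auto
  also have "\<dots> = (\<integral>\<^sup>+z. (\<integral>\<^sup>+s. ennreal (1 / pi) * ennreal (exp (- s)) *
      indicator {z. a < (cmod z)\<^sup>2 \<and> (cmod z)\<^sup>2 \<le> s} z \<partial>lborel) \<partial>lborel)"
  proof (rule nn_integral_cong)
    fix z :: complex
    have "(\<integral>\<^sup>+s. ennreal (1 / pi) * ennreal (exp (- s)) *
        indicator {z. a < (cmod z)\<^sup>2 \<and> (cmod z)\<^sup>2 \<le> s} z \<partial>lborel)
      = (\<integral>\<^sup>+s. (ennreal (1 / pi) * indicator {z. a < (cmod z)\<^sup>2} z) *
         (ennreal (exp (- s)) * indicator {(cmod z)\<^sup>2..} s) \<partial>lborel)"
      by (intro nn_integral_cong) (auto simp: indicator_def)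
    also have "\<dots> = (ennreal (1 / pi) * indicator {z. a < (cmod z)\<^sup>2} z) * ennreal (exp (- (cmod z)\<^sup>2))"
      by (subst nn_integral_cmult) (simp_all add: nn_integral_exp_tail)
    also have "\<dots> = ennreal (exp (- (cmod z)\<^sup>2) / pi) * indicator {z. a < (cmod z)\<^sup>2} z"
      by (auto simp: indicator_def ennreal_mult[symmetric] field_simps)
    finally show "ennreal (exp (- (cmod z)\<^sup>2) / pi) * indicator {z. a < (cmod z)\<^sup>2} z
      = (\<integral>\<^sup>+s. ennreal (1 / pi) * ennreal (exp (- s)) *
        indicator {z. a < (cmod z)\<^sup>2 \<and> (cmod z)\<^sup>2 \<le> s} z \<partial>lborel)" by simp
  qed
  also have "\<dots> = (\<integral>\<^sup>+s. (\<integral>\<^sup>+z. ennreal (1 / pi) * ennreal (exp (- s)) *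
      indicator {z. a < (cmod z)\<^sup>2 \<and> (cmod z)\<^sup>2 \<le> s} z \<partial>lborel) \<partial>lborel)"
    by (rule lborel_pair.Fubini') measurable
  also have "\<dots> = (\<integral>\<^sup>+s. ennreal ((s - a) * exp (- s)) * indicator {a..} s \<partial>lborel)"
  proof (rule nn_integral_cong)
    fix s :: real
    have "(\<integral>\<^sup>+z. ennreal (1 / pi) * ennreal (exp (- s)) *
        indicator {z. a < (cmod z)\<^sup>2 \<and> (cmod z)\<^sup>2 \<le> s} z \<partial>lborel)
      = ennreal (1 / pi) * ennreal (exp (- s)) *
        emeasure lborel {z. a < (cmod z)\<^sup>2 \<and> (cmod z)\<^sup>2 \<le> s}"
      by (rule nn_integral_cmult_indicator) measurable
    also have "\<dots> = ennreal ((s - a) * exp (- s)) * indicator {a..} s"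
    proof (cases "a \<le> s")
      case True
      then show ?thesis
        using assms by (simp add: emeasure_annulus ennreal_mult[symmetric] field_simps)
    next
      case False
      then have "{z :: complex. a < (cmod z)\<^sup>2 \<and> (cmod z)\<^sup>2 \<le> s} = {}" by auto
      then show ?thesis using False by (simp only: emeasure_empty) simp
    qed
    finally show "(\<integral>\<^sup>+z. ennreal (1 / pi) * ennreal (exp (- s)) *
        indicator {z. a < (cmod z)\<^sup>2 \<and> (cmod z)\<^sup>2 \<le> s} z \<partial>lborel)
      = ennreal ((s - a) * exp (- s)) * indicator {a..} s" .
  qed
  also have "\<dots> = ennreal (exp (- a))"
    by (rule nn_integral_shifted_exp_tail)
  finally show ?thesis .
qed

text \<open>The tail formula at \<open>a = 0\<close> gives mass 1 to the plane without the origin,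
  and the origin is a null set.\<close>

lemma prob_space_CN_std: "prob_space CN_std"
proof
  have "emeasure CN_std (space CN_std) = emeasure CN_std {z. 0 < (cmod z)\<^sup>2}"
  proof (rule emeasure_eq_AE)
    have "AE z in lborel. z \<noteq> (0::complex)"
      by (rule AE_lborel_singleton)
    then show "AE z in CN_std. (z \<in> space CN_std) = (z \<in> {z. 0 < (cmod z)\<^sup>2})"
      unfolding CN_std_def by (subst AE_density) auto
  qed measurable
  then show "emeasure CN_std (space CN_std) = 1"
    using emeasure_CN_std_tail[of 0] by simp
qed

lemma distributed_CN_std_cmod_square:
  "distributed CN_std lborel (\<lambda>z. (cmod z)\<^sup>2) (exponential_density 1)"
proof -
  interpret prob_space CN_std by (rule prob_space_CN_std)
  show ?thesis
  proof (rule exponential_distributedI)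
    fix a :: real assume a: "0 \<le> a"
    have "{z \<in> space CN_std. (cmod z)\<^sup>2 \<le> a} = space CN_std - {z. a < (cmod z)\<^sup>2}" by auto
    also have "emeasure CN_std \<dots> = 1 - ennreal (exp (- a))"
      by (subst emeasure_compl) (auto simp: emeasure_space_1 emeasure_CN_std_tail a simp del: space_CN_std)
    finally show "emeasure CN_std {z \<in> space CN_std. (cmod z)\<^sup>2 \<le> a} = 1 - ennreal (exp (- a * 1))"
      by simp
  qed auto
qed

section \<open>From a single entry to the channel vector\<close>

lemma prob_space_chan: "prob_space (chan t)"
  unfolding chan_def by (rule prob_space_PiM) (rule prob_space_CN_std)

lemma distributed_chan_cmod_square:
  assumes "k \<in> {1..t}"
  shows "distributed (chan t) lborel (\<lambda>h. (cmod (h k))\<^sup>2) (exponential_density 1)"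
proof -
  have distr_k: "distr (chan t) CN_std (\<lambda>h. h k) = CN_std"
    unfolding chan_def using assms by (intro distr_PiM_component prob_space_CN_std) auto
  have "distr (chan t) lborel (\<lambda>h. (cmod (h k))\<^sup>2)
      = distr (distr (chan t) CN_std (\<lambda>h. h k)) lborel (\<lambda>z. (cmod z)\<^sup>2)"
    using assms by (subst distr_distr) (auto simp: chan_def comp_def)
  also have "\<dots> = distr CN_std lborel (\<lambda>z. (cmod z)\<^sup>2)"
    by (simp only: distr_k)
  finally show ?thesis
    using distributed_CN_std_cmod_square assms by (auto simp: distributed_def chan_def)
qed

text \<open>Independence amounts to the joint law being the product of the marginals. The joint map
  is the identity on extensional functions, so its law is \<open>chan t\<close>, a product measure
  whose marginals are \<open>CN_std\<close> by projection.\<close>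

lemma indep_vars_chan:
  assumes "1 \<le> t"
  shows "prob_space.indep_vars (chan t) (\<lambda>_. CN_std) (\<lambda>k h. h k) {1..t}"
proof -
  interpret prob_space "chan t" by (rule prob_space_chan)
  have comp: "k \<in> {1..t} \<Longrightarrow> (\<lambda>h. h k) \<in> measurable (chan t) CN_std" for k
    by (auto simp: chan_def)
  have "distr (chan t) (Pi\<^sub>M {1..t} (\<lambda>_. CN_std)) (\<lambda>h. \<lambda>k\<in>{1..t}. h k)
      = distr (chan t) (chan t) (\<lambda>h. h)"
    by (rule distr_cong) (auto simp: chan_def space_PiM PiE_def extensional_restrict)
  also have "\<dots> = chan t" by simp
  also have "\<dots> = Pi\<^sub>M {1..t} (\<lambda>k. distr (chan t) CN_std (\<lambda>h. h k))"
    unfolding chan_def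
    by (rule PiM_cong) (auto intro!: distr_PiM_component[symmetric] prob_space_CN_std)
  finally show ?thesis
    using assms comp by (subst indep_vars_iff_distr_eq_PiM') auto
qed

text \<open>A sum of \<open>i\<close> independent rate-1 exponentials is Erlang. The first parameter
  of \<open>erlang_density\<close> is the number of stages minus one, hence
  \<open>i - 1\<close>.\<close>

lemma distributed_prefix_normsq:
  assumes "1 \<le> i" "i \<le> t"
  shows "distributed (chan t) lborel (\<lambda>h. prefix_normsq h i) (erlang_density (i - 1) 1)"
proof -
  interpret prob_space "chan t" by (rule prob_space_chan)
  have "distributed (chan t) lborel (\<lambda>h. \<Sum>k\<in>{1..i}. (cmod (h k))\<^sup>2)
      (erlang_density (card {1..i} - 1) 1)"
  proof (rule exponential_distributed_sum)
    show "indep_vars (\<lambda>_. borel) (\<lambda>k h. (cmod (h k))\<^sup>2) {1..i}"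
    proof (rule indep_vars_subset)
      show "indep_vars (\<lambda>_. borel) (\<lambda>k h. (cmod (h k))\<^sup>2) {1..t}"
        by (rule indep_vars_compose2[OF indep_vars_chan]) (use assms in auto)
    qed (use assms in auto)
  qed (use assms in \<open>auto intro!: distributed_chan_cmod_square\<close>)
  then show ?thesis by (simp add: prefix_normsq_def)
qed

section \<open>Quantized beamforming and feedback length\<close>

text \<open>Quantization rounds the modulus down and keeps the sign, and the floor loses less than
  one step \<open>1 / 2 ^ (l + 1)\<close>; this loss is then weighted by the modulus of
  \<open>x\<close>.\<close>

lemma quant_mult_self_ge: "x * quant x l \<ge> x\<^sup>2 - \<bar>x\<bar> / 2 ^ (l + 1)"
proof -
  define p :: real where "p = 2 ^ (l + 1)"
  have p: "p > 0" by (simp add: p_def)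
  have "\<bar>x\<bar> * (\<bar>x\<bar> * p - 1) \<le> \<bar>x\<bar> * of_int \<lfloor>\<bar>x\<bar> * p\<rfloor>"
    by (intro mult_left_mono) linarith+
  then have "\<bar>x\<bar> * (\<bar>x\<bar> * p - 1) / p \<le> \<bar>x\<bar> * of_int \<lfloor>\<bar>x\<bar> * p\<rfloor> / p"
    using p by (intro divide_right_mono) auto
  moreover have "\<bar>x\<bar> * (\<bar>x\<bar> * p - 1) / p = x\<^sup>2 - \<bar>x\<bar> / p"
    using p by (simp add: field_simps power2_eq_square)
  moreover have "x * quant x l = \<bar>x\<bar> * of_int \<lfloor>\<bar>x\<bar> * p\<rfloor> / p"
    by (simp add: quant_def p_def abs_sgn mult.assoc)
  ultimately show ?thesis by (simp add: p_def)
qed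

lemma prefix_normsq_mono: "i \<le> j \<Longrightarrow> prefix_normsq h i \<le> prefix_normsq h j"
  unfolding prefix_normsq_def by (intro sum_mono2) auto

text \<open>With \<open>y = i / 2 ^ Lq\<close> as the relative amplitude loss, the first bound says
  that \<open>y\<close> is at most 1/4, the second that \<open>\<alpha> * y\<close> is at most a
  quarter of the surplus energy \<open>prefix_normsq h i - \<alpha>\<close>.\<close>

lemma Lq_lower:
  assumes "1 \<le> i" "0 < \<alpha>" "\<alpha> < prefix_normsq h i"
  shows "4 * real i \<le> 2 ^ Lq \<alpha> h i"
    and "4 * real i * \<alpha> / (prefix_normsq h i - \<alpha>) \<le> 2 ^ Lq \<alpha> h i"
proof -
  have *: "x \<le> 2 ^ n" if "0 < x" "log 2 x \<le> real n" for x :: real and n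
    using that by (simp add: log_le_iff powr_realpow)
  have "log 2 (4 * real i) \<le> real (Lq \<alpha> h i)"
    unfolding Lq_def by linarith
  then show "4 * real i \<le> 2 ^ Lq \<alpha> h i"
    using assms by (intro *) auto
  have "log 2 (4 * real i * \<alpha> / (prefix_normsq h i - \<alpha>)) \<le> real (Lq \<alpha> h i)"
    unfolding Lq_def by linarith
  then show "4 * real i * \<alpha> / (prefix_normsq h i - \<alpha>) \<le> 2 ^ Lq \<alpha> h i"
    using assms by (intro *) auto
qed

text \<open>The normalized vector \<open>u\<close> has \<open>2 * i\<close> real coordinates, each
  of modulus at most 1. Quantizing one coordinate costs at most \<open>d = 1 / 2 ^ (l + 1)\<close>
  of the inner product, which makes \<open>i / 2 ^ l\<close> in total.\<close>

lemma Re_inner_Ci_ge: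
  assumes "1 \<le> i" "0 < prefix_normsq h i"
  shows "Re (\<Sum>k=1..i. cnj (Ci \<alpha> h i k) * h k)
     \<ge> sqrt (prefix_normsq h i) * (1 - real i / 2 ^ Lq \<alpha> h i)"
proof -
  define G s l d where "G = prefix_normsq h i" and "s = sqrt G" and "l = Lq \<alpha> h i"
    and "d = 1 / (2 :: real) ^ (l + 1)"
  define u where "u k = h k / complex_of_real s" for k
  have s: "s > 0" and ss: "s * s = G" using assms by (auto simp: s_def G_def)
  have d: "d > 0" by (simp add: d_def)
  have hu: "h k = complex_of_real s * u k" for k
    using s by (simp add: u_def)
  have Re_h: "Re (h k) = s * Re (u k)" and Im_h: "Im (h k) = s * Im (u k)" for k
    by (simp_all add: hu)
  have C: "Ci \<alpha> h i k = Complex (quant (Re (u k)) l) (quant (Im (u k)) l)" for k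
    by (simp add: Ci_def quant_vec_def u_def s_def G_def l_def)
  have sq: "(cmod (u k))\<^sup>2 = (cmod (h k))\<^sup>2 / G" for k
    using s ss by (simp add: u_def norm_divide power_divide power2_eq_square)
  have sum1: "(\<Sum>k=1..i. (cmod (u k))\<^sup>2) = 1"
    using assms by (simp add: sq sum_divide_distrib[symmetric] G_def prefix_normsq_def)
  have le1: "cmod (u k) \<le> 1" if "k \<in> {1..i}" for k
  proof -
    have "(cmod (u k))\<^sup>2 \<le> (\<Sum>k=1..i. (cmod (u k))\<^sup>2)"
      using that by (intro member_le_sum) auto
    then show ?thesis by (simp only: sum1) (simp add: abs_square_le_1)
  qed
  have term_ge: "Re (cnj (Ci \<alpha> h i k) * h k) \<ge> s * ((cmod (u k))\<^sup>2 - 2 * d)" if "k \<in> {1..i}" for k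
  proof -
    have "Re (cnj (Ci \<alpha> h i k) * h k)
        = s * (Re (u k) * quant (Re (u k)) l + Im (u k) * quant (Im (u k)) l)"
      by (simp add: C Re_h Im_h algebra_simps)
    moreover have "Re (u k) * quant (Re (u k)) l + Im (u k) * quant (Im (u k)) l
        \<ge> ((Re (u k))\<^sup>2 - \<bar>Re (u k)\<bar> * d) + ((Im (u k))\<^sup>2 - \<bar>Im (u k)\<bar> * d)"
      using quant_mult_self_ge[of "Re (u k)" l] quant_mult_self_ge[of "Im (u k)" l]
      by (simp add: d_def)
    moreover have "\<bar>Re (u k)\<bar> * d \<le> 1 * d" "\<bar>Im (u k)\<bar> * d \<le> 1 * d"
      using abs_Re_le_cmod[of "u k"] abs_Im_le_cmod[of "u k"] le1[OF that] d
      by (intro mult_right_mono; linarith)+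
    ultimately show ?thesis
      using s by (simp add: cmod_power2)
  qed
  have "s * (1 - real i / 2 ^ l) = (\<Sum>k=1..i. s * ((cmod (u k))\<^sup>2 - 2 * d))"
    unfolding sum_distrib_left[symmetric] sum_subtractf sum1 by (simp add: d_def)
  also have "\<dots> \<le> (\<Sum>k=1..i. Re (cnj (Ci \<alpha> h i k) * h k))"
    by (rule sum_mono) (rule term_ge)
  finally show ?thesis by (simp add: s_def G_def l_def)
qed

section \<open>The stopping rule and the outage event\<close>

lemma D_stop_None:
  assumes "D_stop \<alpha> t h = None" "1 \<le> i" "i \<le> t"
  shows "prefix_normsq h i \<le> \<alpha>"
  using assms by (force simp: D_stop_def split: if_splits)

lemma D_stop_Some:
  assumes "D_stop \<alpha> t h = Some i"
  shows "1 \<le> i" "i \<le> t" "\<alpha> < prefix_normsq h i"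
    and "\<And>j. 1 \<le> j \<Longrightarrow> j < i \<Longrightarrow> prefix_normsq h j \<le> \<alpha>"
proof -
  from assms have ex: "\<exists>i. i \<in> {1..t} \<and> prefix_normsq h i > \<alpha>"
    and i: "i = (LEAST i. i \<in> {1..t} \<and> prefix_normsq h i > \<alpha>)"
    by (auto simp: D_stop_def split: if_splits)
  have *: "i \<in> {1..t} \<and> prefix_normsq h i > \<alpha>"
    unfolding i by (rule LeastI_ex[OF ex])
  then show "1 \<le> i" "i \<le> t" "\<alpha> < prefix_normsq h i" by auto
  fix j assume "1 \<le> j" "j < i"
  then show "prefix_normsq h j \<le> \<alpha>"
    using not_less_Least[of j "\<lambda>i. i \<in> {1..t} \<and> prefix_normsq h i > \<alpha>"] *
    unfolding i[symmetric] by auto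
qed

text \<open>The received energy is at least \<open>G * (1 - y)\<^sup>2\<close>, hence at least
  \<open>G * (1 - 2 * y)\<close>, and the two terms of the maximum in \<open>Lq\<close> keep this
  above \<open>\<alpha>\<close>.\<close>

lemma D_beam_Some_no_outage:
  assumes "0 < \<alpha>" and stop: "D_stop \<alpha> t h = Some i"
  shows "\<alpha> \<le> (cmod (cinner t (D_beam \<alpha> t h) h))\<^sup>2"
proof -
  define G where "G = prefix_normsq h i"
  define y where "y = real i / 2 ^ Lq \<alpha> h i"
  note i = D_stop_Some(1-3)[OF stop]
  have G: "0 < G" "\<alpha> < G" using i assms by (auto simp: G_def)
  have y0: "0 \<le> y" by (simp add: y_def)
  have y1: "y \<le> 1 / 4"
    using Lq_lower(1)[OF i(1) assms(1) i(3)] by (simp add: y_def field_simps)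
  have y2: "4 * (\<alpha> * y) \<le> G - \<alpha>"
    using Lq_lower(2)[OF i(1) assms(1) i(3)] G by (simp add: y_def G_def field_simps)
  have "\<alpha> \<le> G * (1 - 2 * y)"
  \<comment> \<open>Near the threshold, \<open>2 * G * y\<close> is at most
    \<open>4 * \<alpha> * y\<close>, which the surplus \<open>G - \<alpha>\<close> covers. Far from
    it, \<open>y \<le> 1 / 4\<close> already leaves half of \<open>G\<close>.\<close>
  proof (cases "G \<le> 2 * \<alpha>")
    case True
    then have "G * y \<le> 2 * \<alpha> * y" using y0 by (intro mult_right_mono)
    then show ?thesis using y2 by (simp add: algebra_simps)
  next
    case False
    have "G * (1 / 2) \<le> G * (1 - 2 * y)" using y1 G by (intro mult_left_mono) auto
    then show ?thesis using False by simp
  qed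
  also have "\<dots> \<le> G * (1 - y)\<^sup>2"
    using G by (intro mult_left_mono) (auto simp: power2_eq_square algebra_simps)
  also have "\<dots> = (sqrt G * (1 - y))\<^sup>2"
    using G by (simp add: power_mult_distrib)
  also have "\<dots> \<le> (cmod (\<Sum>k=1..i. cnj (Ci \<alpha> h i k) * h k))\<^sup>2"
  proof (rule power_mono)
    have "sqrt G * (1 - y) \<le> Re (\<Sum>k=1..i. cnj (Ci \<alpha> h i k) * h k)"
      using Re_inner_Ci_ge[of i h \<alpha>] i(1) G by (simp add: G_def y_def)
    also have "\<dots> \<le> cmod (\<Sum>k=1..i. cnj (Ci \<alpha> h i k) * h k)"
      by (rule complex_Re_le_cmod)
    finally show "sqrt G * (1 - y) \<le> cmod (\<Sum>k=1..i. cnj (Ci \<alpha> h i k) * h k)" .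
  qed (use G y1 in auto)
  also have "(\<Sum>k=1..i. cnj (Ci \<alpha> h i k) * h k) = cinner t (D_beam \<alpha> t h) h"
    unfolding cinner_def D_beam_def stop using i
    by (intro sum.mono_neutral_cong_left) auto
  finally show ?thesis .
qed

lemma cinner_D_beam_None:
  assumes "1 \<le> t" "D_stop \<alpha> t h = None"
  shows "cinner t (D_beam \<alpha> t h) h = h 1"
proof -
  have "cinner t (D_beam \<alpha> t h) h = (\<Sum>k\<in>{1}. h k)"
    unfolding cinner_def D_beam_def assms(2) option.case using assms(1)
    by (intro sum.mono_neutral_cong_right) auto
  then show ?thesis by simp
qed

text \<open>A stop rules out outage; without one, the fallback beam along the first basis vector
  receives exactly the energy of \<open>h 1\<close>.\<close>

lemma D_beam_outage_iff:
  assumes "1 \<le> t" "0 < \<alpha>"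
  shows "(cmod (cinner t (D_beam \<alpha> t h) h))\<^sup>2 < \<alpha>
     \<longleftrightarrow> prefix_normsq h t \<le> \<alpha> \<and> (cmod (h 1))\<^sup>2 < \<alpha>"
proof (cases "D_stop \<alpha> t h")
  case None
  then show ?thesis
    using cinner_D_beam_None[OF assms(1) None] D_stop_None[OF None assms(1) order_refl] by simp
next
  case (Some i)
  have "\<alpha> < prefix_normsq h t"
    using D_stop_Some(2,3)[OF Some] prefix_normsq_mono[of i t h] by linarith
  then show ?thesis
    using D_beam_Some_no_outage[OF assms(2) Some] by simp
qed

text \<open>The majorant \<^term>\<open>3 * (sqrt z - 1)\<close> of \<^term>\<open>log 2 z\<close> has an antiderivative that is
  continuous up to the singularity, which makes its integral elementary.\<close>

definition overshoot_bits :: "real \<Rightarrow> real \<Rightarrow> real" where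
  "overshoot_bits \<alpha> x = 3 * (sqrt (\<alpha> / (x - \<alpha>)) - 1) * indicator {\<alpha><..2 * \<alpha>} x"

lemma overshoot_bits_nonneg: "0 \<le> overshoot_bits \<alpha> x"
  by (auto simp: overshoot_bits_def indicator_def field_simps)

text \<open>The constant 3 comes from \<open>ln x = 2 * ln (sqrt x) \<le> 2 * (sqrt x - 1)\<close>
  together with \<open>ln 2 \<ge> 2 / 3\<close>.\<close>

lemma log2_le_sqrt:
  assumes "1 \<le> x"
  shows "log 2 x \<le> 3 * (sqrt x - 1)"
proof -
  have "ln x = 2 * ln (sqrt x)" using assms by (simp add: ln_sqrt)
  also have "\<dots> \<le> 2 * (sqrt x - 1)" using assms ln_le_minus_one[of "sqrt x"] by simp
  also have "\<dots> = 3 * (sqrt x - 1) * (2 / 3)" by simp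
  also have "\<dots> \<le> 3 * (sqrt x - 1) * ln 2"
    using assms ln2_ge_two_thirds by (intro mult_left_mono) auto
  finally show ?thesis by (simp add: log_def divide_le_eq)
qed

lemma log2_nat_le: "1 \<le> i \<Longrightarrow> log 2 (real i) \<le> real i - 1"
proof -
  assume i: "1 \<le> i"
  have "i \<le> 2 ^ (i - 1)" using i
    by (induction i rule: dec_induct) (auto simp: Suc_le_eq)
  then have "real i \<le> 2 ^ (i - 1)" by (metis of_nat_le_iff of_nat_numeral of_nat_power)
  also have "\<dots> = 2 powr (real i - 1)"
    using i by (simp add: powr_realpow[symmetric] of_nat_diff)
  finally have "real i \<le> 2 powr (real i - 1)" .
  then show ?thesis using i by (simp add: log_le_iff)
qed

text \<open>Rounding up costs at most 1 and \<open>log 2 (4 * i)\<close> is at most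
  \<open>2 + (i - 1)\<close>, giving \<open>i + 2\<close>. The second logarithm exceeds the first by
  \<open>log 2 (\<alpha> / (G - \<alpha>))\<close>, which is positive only for \<open>G\<close>
  below \<open>2 * \<alpha>\<close>.\<close>

lemma Lq_upper:
  assumes "1 \<le> i" "0 < \<alpha>" "\<alpha> < prefix_normsq h i"
  shows "real (Lq \<alpha> h i) \<le> real i + 2 + overshoot_bits \<alpha> (prefix_normsq h i)"
proof -
  define G where "G = prefix_normsq h i"
  have G: "\<alpha> < G" using assms by (simp add: G_def)
  have l1: "log 2 (4 * real i) = 2 + log 2 (real i)"
    using assms by (simp add: log_mult log_pow_cancel[of 2 2, simplified])
  have l2: "log 2 (4 * real i * \<alpha> / (G - \<alpha>)) = 2 + log 2 (real i) + log 2 (\<alpha> / (G - \<alpha>))"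
    using assms G l1 log_mult[of 2 "4 * real i" "\<alpha> / (G - \<alpha>)"] by simp
  have over: "log 2 (\<alpha> / (G - \<alpha>)) \<le> overshoot_bits \<alpha> G"
  proof (cases "G \<le> 2 * \<alpha>")
    case True
    then show ?thesis
      using G log2_le_sqrt[of "\<alpha> / (G - \<alpha>)"] by (simp add: overshoot_bits_def)
  next
    case False
    then have "log 2 (\<alpha> / (G - \<alpha>)) \<le> 0" using assms by simp
    then show ?thesis using overshoot_bits_nonneg[of \<alpha> G] by linarith
  qed
  have "0 \<le> log 2 (real i)" using assms by simp
  then show ?thesis
    unfolding Lq_def G_def[symmetric] l1 l2
    using over log2_nat_le[OF assms(1)] overshoot_bits_nonneg[of \<alpha> G] by linarith
qed

section \<open>Pointwise bounds by sums over prefixes\<close>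

text \<open>Replaces the stopping index by a sum of functions of one prefix energy each, so that
  expectations require only the marginal laws.\<close>

lemma card_silent_prefixes_le:
  assumes "n \<le> t" "\<And>j. 1 \<le> j \<Longrightarrow> j \<le> n \<Longrightarrow> prefix_normsq h j \<le> \<alpha>"
  shows "real n \<le> (\<Sum>j=1..t. indicator {..\<alpha>} (prefix_normsq h j))"
proof -
  have "real n = (\<Sum>j=1..n. indicator {..\<alpha>} (prefix_normsq h j))"
    using assms(2) by simp
  also have "\<dots> \<le> (\<Sum>j=1..t. indicator {..\<alpha>} (prefix_normsq h j))"
    using assms(1) by (intro sum_mono2) auto
  finally show ?thesis .
qed

lemma D_trained_le:
  "real (D_trained \<alpha> t h) \<le> 1 + (\<Sum>j=1..t. indicator {..\<alpha>} (prefix_normsq h j))"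
proof (cases "D_stop \<alpha> t h")
  case None
  then show ?thesis
    using card_silent_prefixes_le[OF order_refl, of t h \<alpha>] D_stop_None[OF None]
    by (force simp only: D_trained_def option.case)
next
  case (Some i)
  note i = D_stop_Some[OF Some]
  have "real (i - 1) \<le> (\<Sum>j=1..t. indicator {..\<alpha>} (prefix_normsq h j))"
    using i by (intro card_silent_prefixes_le) auto
  then show ?thesis using Some i(1) by (simp add: D_trained_def of_nat_diff)
qed

text \<open>A stop at \<open>i\<close> costs \<open>i - 1\<close> zero bits and a codeword of at
  most \<open>2 * i * (i + 5)\<close> bits plus overshoot. For \<open>i \<ge> 2\<close> the prefix
  \<open>j = i - 1\<close> was silent, so the codeword is charged to it as
  \<open>2 * (j + 1) * (j + 6)\<close>; for \<open>i = 1\<close> it is the constant 12. The summand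
  1 counts the zero bits, and the overshoot is charged to prefix \<open>i\<close> itself.\<close>

lemma D_bits_le:
  assumes "0 < \<alpha>"
  shows "real (D_bits \<alpha> t h) \<le> 12 + (\<Sum>j=1..t.
     (2 * (real j + 1) * (real j + 6) + 1) * indicator {..\<alpha>} (prefix_normsq h j)
     + 2 * real j * overshoot_bits \<alpha> (prefix_normsq h j))"
    (is "_ \<le> 12 + sum ?f _")
proof -
  define Z where "Z = (\<Sum>j=1..t. indicator {..\<alpha>} (prefix_normsq h j) :: real)"
  define A where "A = (\<Sum>j=1..t. 2 * (real j + 1) * (real j + 6) *
    indicator {..\<alpha>} (prefix_normsq h j))"
  define B where "B = (\<Sum>j=1..t. 2 * real j * overshoot_bits \<alpha> (prefix_normsq h j))"
  have split: "sum ?f {1..t} = Z + A + B"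
    unfolding Z_def A_def B_def sum.distrib[symmetric] by (rule sum.cong) (auto simp: algebra_simps)
  have A0: "0 \<le> A" unfolding A_def by (intro sum_nonneg) auto
  have B0: "0 \<le> B" unfolding B_def by (intro sum_nonneg) (auto simp: overshoot_bits_nonneg)
  show ?thesis
  proof (cases "D_stop \<alpha> t h")
    case None
    have "real t \<le> Z"
      unfolding Z_def using D_stop_None[OF None] by (intro card_silent_prefixes_le) auto
    then show ?thesis using None A0 B0 unfolding split by (simp add: D_bits_def)
  next
    case (Some i)
    note i = D_stop_Some[OF Some]
    define v where "v = overshoot_bits \<alpha> (prefix_normsq h i)"
    have Z: "real (i - 1) \<le> Z"
      unfolding Z_def using i by (intro card_silent_prefixes_le) auto
    have B: "2 * real i * v \<le> B"
      unfolding B_def v_def using i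
      by (intro member_le_sum[of i _ "\<lambda>j. 2 * real j * overshoot_bits \<alpha> (prefix_normsq h j)"])
         (auto simp: overshoot_bits_nonneg)
    have A: "2 * real i * (real i + 5) \<le> 12 + A"
    proof (cases "i = 1")
      case True
      then show ?thesis using A0 by simp
    next
      case False
      then have "2 * (real (i - 1) + 1) * (real (i - 1) + 6) *
          indicator {..\<alpha>} (prefix_normsq h (i - 1)) \<le> A"
        unfolding A_def using i
        by (intro member_le_sum[of "i - 1" _ "\<lambda>j. 2 * (real j + 1) * (real j + 6) *
             indicator {..\<alpha>} (prefix_normsq h j)"]) auto
      then show ?thesis using False i by (simp add: of_nat_diff algebra_simps)
    qed
    have "2 * real i * (real (Lq \<alpha> h i) + 3) \<le> 2 * real i * (real i + 5 + v)"
      using Lq_upper[OF i(1) assms i(3)] by (intro mult_left_mono) (auto simp: v_def)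
    also have "\<dots> = 2 * real i * (real i + 5) + 2 * real i * v"
      by (simp add: algebra_simps)
    finally show ?thesis
      using Some Z A B unfolding split by (simp add: D_bits_def)
  qed
qed

section \<open>Outage probability and expected rates\<close>

lemma measurable_chan_component [measurable]:
  "k \<in> {1..t} \<Longrightarrow> (\<lambda>h. h k) \<in> borel_measurable (chan t)"
  using measurable_component_singleton[of k "{1..t}" "\<lambda>_. CN_std"]
  by (simp add: chan_def cong: measurable_cong_sets)

lemma measurable_prefix_normsq [measurable]:
  assumes "i \<le> t"
  shows "(\<lambda>h. prefix_normsq h i) \<in> borel_measurable (chan t)"
  unfolding prefix_normsq_def using assms
  by (intro borel_measurable_sum borel_measurable_power borel_measurable_norm) auto

text \<open>The Erlang law has a density, hence no atoms.\<close>

lemma AE_prefix_normsq_neq: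
  assumes "1 \<le> i" "i \<le> t"
  shows "AE h in chan t. prefix_normsq h i \<noteq> a"
proof -
  note D = distributed_prefix_normsq[OF assms]
  have "AE x in lborel. x \<noteq> a" by (rule AE_lborel_singleton)
  then have "AE x in distr (chan t) lborel (\<lambda>h. prefix_normsq h i). x \<noteq> a"
    unfolding distributed_distr_eq_density[OF D] by (subst AE_density) auto
  then show ?thesis
    by (subst (asm) AE_distr_iff) (use assms in auto)
qed

text \<open>Off the null event \<open>prefix_normsq h t = \<alpha>\<close> the weak and strict
  inequalities agree, and the condition on \<open>h 1\<close> follows because its energy is part of
  the total.\<close>

lemma outage_D_beam:
  assumes "1 \<le> t" "0 < \<alpha>"
  shows "outage t \<alpha> (D_beam \<alpha> t) = outage_F t \<alpha>"
proof -
  interpret prob_space "chan t" by (rule prob_space_chan)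
  have one: "1 \<in> {1..t}" using assms by simp
  note [measurable] = measurable_chan_component[OF one] measurable_prefix_normsq[OF order_refl, of t]
  have le: "(cmod (h 1))\<^sup>2 \<le> prefix_normsq h t" for h
    using prefix_normsq_mono[of 1 t h] assms by (simp add: prefix_normsq_def)
  show ?thesis
    unfolding outage_def outage_F_def D_beam_outage_iff[OF assms]
  proof (rule finite_measure_eq_AE)
    show "AE h in chan t. h \<in> {h \<in> space (chan t). prefix_normsq h t \<le> \<alpha> \<and> (cmod (h 1))\<^sup>2 < \<alpha>}
        \<longleftrightarrow> h \<in> {h \<in> space (chan t). prefix_normsq h t < \<alpha>}"
      using AE_prefix_normsq_neq[OF assms(1) order_refl, of \<alpha>]
    proof eventually_elim
      case (elim h)
      then show ?case using le[of h] by auto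
    qed
  qed measurable
qed

section \<open>Reduction to Poisson moments and the overshoot integral\<close>

text \<open>By linearity each summand is integrated against its own Erlang law; pulling the sum back
  inside gives, at fixed \<open>x\<close>, a partial Poisson expectation.\<close>

lemma nn_integral_sum_prefix_normsq:
  fixes \<psi> :: "nat \<Rightarrow> real \<Rightarrow> real"
  assumes [measurable]: "\<And>j. \<psi> j \<in> borel_measurable borel" and nonneg: "\<And>j x. 0 \<le> \<psi> j x"
  shows "(\<integral>\<^sup>+h. ennreal (\<Sum>j=1..t. \<psi> j (prefix_normsq h j)) \<partial>chan t)
       = (\<integral>\<^sup>+x. ennreal (\<Sum>j=1..t. erlang_density (j - 1) 1 x * \<psi> j x) \<partial>lborel)"
proof -
  have "(\<integral>\<^sup>+h. ennreal (\<Sum>j=1..t. \<psi> j (prefix_normsq h j)) \<partial>chan t)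
      = (\<Sum>j=1..t. \<integral>\<^sup>+h. ennreal (\<psi> j (prefix_normsq h j)) \<partial>chan t)"
    by (subst nn_integral_sum[symmetric])
       (auto simp: nonneg intro!: nn_integral_cong measurable_compose[OF measurable_prefix_normsq])
  also have "\<dots> = (\<Sum>j=1..t. \<integral>\<^sup>+x. ennreal (erlang_density (j - 1) 1 x) * ennreal (\<psi> j x) \<partial>lborel)"
    by (intro sum.cong refl distributed_nn_integral[symmetric] distributed_prefix_normsq) auto
  also have "\<dots> = (\<integral>\<^sup>+x. (\<Sum>j=1..t. ennreal (erlang_density (j - 1) 1 x) * ennreal (\<psi> j x)) \<partial>lborel)"
    by (subst nn_integral_sum) auto
  also have "\<dots> = (\<integral>\<^sup>+x. ennreal (\<Sum>j=1..t. erlang_density (j - 1) 1 x * \<psi> j x) \<partial>lborel)"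
    by (intro nn_integral_cong) (simp add: nonneg ennreal_mult[symmetric])
  finally show ?thesis .
qed

text \<open>For \<open>x \<ge> 0\<close> the numbers \<^term>\<open>erlang_density m 1 x\<close> are the Poisson weights of mean \<open>x\<close>;
  the next three bounds are their partial factorial moments.\<close>

lemma sum_erlang_density_le:
  assumes "0 \<le> x"
  shows "(\<Sum>m<n. erlang_density m 1 x) \<le> 1"
proof -
  have "(\<Sum>m<n. erlang_density m 1 x) = exp (- x) * (\<Sum>m<n. x ^ m /\<^sub>R fact m)"
    using assms by (simp add: erlang_density_def sum_distrib_left field_simps)
  also have "\<dots> \<le> exp (- x) * exp x"
    using assms exp_converges[of x] sum_le_suminf[of "\<lambda>m. x ^ m /\<^sub>R fact m" "{..<n}"]
    by (intro mult_left_mono) (auto simp: sums_iff)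
  finally show ?thesis by (simp add: exp_minus_inverse mult.commute)
qed

text \<open>This recursion of the Poisson weights lowers the order of a factorial moment by one at
  the price of a factor \<open>x\<close>.\<close>

lemma erlang_density_Suc:
  "real (Suc m) * erlang_density (Suc m) 1 x = x * erlang_density m 1 x"
  by (simp add: erlang_density_def mult_ac del: of_nat_Suc)

lemma sum_erlang_density_moment1_le:
  assumes "0 \<le> x"
  shows "(\<Sum>m<n. real m * erlang_density m 1 x) \<le> x"
proof (cases n)
  case (Suc k)
  have "(\<Sum>m<n. real m * erlang_density m 1 x) = (\<Sum>m<k. x * erlang_density m 1 x)"
    \<comment> \<open>The term for \<open>m = 0\<close> vanishes, so the index shift loses
      nothing.\<close>
    unfolding Suc by (subst sum.lessThan_Suc_shift) (simp add: erlang_density_Suc del: of_nat_Suc)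
  also have "\<dots> \<le> x * 1"
    unfolding sum_distrib_left[symmetric] using assms
    by (intro mult_left_mono sum_erlang_density_le)
  finally show ?thesis by simp
qed (use assms in simp)

lemma sum_erlang_density_moment2_le:
  assumes "0 \<le> x"
  shows "(\<Sum>m<n. real m * (real m - 1) * erlang_density m 1 x) \<le> x\<^sup>2"
proof (cases n)
  case (Suc k)
  have "(\<Sum>m<n. real m * (real m - 1) * erlang_density m 1 x)
      = (\<Sum>m<k. real m * (real (Suc m) * erlang_density (Suc m) 1 x))"
    unfolding Suc by (subst sum.lessThan_Suc_shift) (simp add: mult_ac)
  also have "\<dots> = x * (\<Sum>m<k. real m * erlang_density m 1 x)"
    unfolding erlang_density_Suc by (simp add: sum_distrib_left mult_ac)
  also have "\<dots> \<le> x * x"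
    using assms by (intro mult_left_mono sum_erlang_density_moment1_le)
  finally show ?thesis by (simp add: power2_eq_square)
qed simp

lemma sum_atLeast1_shift: "(\<Sum>j=1..t. f j) = (\<Sum>m<t. f (Suc m))"
  by (simp add: sum.atLeast1_atMost_eq)

lemma borel_measurable_overshoot_bits [measurable]: "overshoot_bits \<alpha> \<in> borel_measurable borel"
  unfolding overshoot_bits_def by measurable

lemma nn_integral_overshoot_bits:
  assumes "0 < \<alpha>"
  shows "(\<integral>\<^sup>+x. ennreal (overshoot_bits \<alpha> x) \<partial>lborel) = ennreal (3 * \<alpha>)"
proof -
  define F where "F x = 3 * (2 * sqrt (\<alpha> * (x - \<alpha>)) - (x - \<alpha>))" for x
  define f where "f x = 3 * (sqrt (\<alpha> / (x - \<alpha>)) - 1)" for x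
  have "(f has_integral F (2 * \<alpha>) - F \<alpha>) {\<alpha>..2 * \<alpha>}"
  \<comment> \<open>\<open>f\<close> is singular at \<open>\<alpha>\<close>, so differentiability is
    asked only inside the interval; \<open>F\<close> is continuous up to both ends, with
    \<open>F \<alpha> = 0\<close> and \<open>F (2 * \<alpha>) = 3 * \<alpha>\<close>.\<close>
  proof (rule fundamental_theorem_of_calculus_interior)
    show "continuous_on {\<alpha>..2 * \<alpha>} F"
      unfolding F_def by (intro continuous_intros)
    fix x assume x: "x \<in> {\<alpha><..<2 * \<alpha>}"
    have s: "sqrt (\<alpha> * (x - \<alpha>)) * sqrt (\<alpha> / (x - \<alpha>)) = \<alpha>"
      using x assms by (simp add: real_sqrt_mult[symmetric] power2_eq_square[symmetric])
    have "(F has_real_derivative f x) (at x)"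
      unfolding F_def f_def using x assms s
      by (auto intro!: derivative_eq_intros simp: field_simps)
    then show "(F has_vector_derivative f x) (at x)"
      by (simp add: has_real_derivative_iff_has_vector_derivative)
  qed (use assms in auto)
  then have "(f has_integral 3 * \<alpha>) {\<alpha>..2 * \<alpha>}"
    using assms by (simp add: F_def real_sqrt_mult_self[simplified])
  \<comment> \<open>At \<open>x = \<alpha>\<close> division by zero gives \<open>f\<close> the value
    -3, whereas \<open>overshoot_bits\<close> is 0 there; a single point does not affect the
    integral.\<close>
  then have "((\<lambda>x. overshoot_bits \<alpha> x) has_integral 3 * \<alpha>) UNIV"
    unfolding has_integral_restrict_UNIV[of _ f, symmetric]
    by (rule has_integral_spike_finite[where S = "{\<alpha>}", rotated 2])
      (auto simp: overshoot_bits_def f_def)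
  then show ?thesis
    by (intro nn_integral_has_integral_lborel) (auto simp: overshoot_bits_nonneg)
qed

section \<open>Expected training length and feedback rate\<close>

text \<open>Poisson weights add up to at most 1, so the integrand is dominated by the indicator of
  \<open>{0..\<alpha>}\<close>, which contributes \<open>\<alpha>\<close>.\<close>

lemma tl_D_le:
  assumes "0 < \<alpha>"
  shows "tl_D \<alpha> t \<le> ennreal (1 + \<alpha>)"
proof -
  interpret prob_space "chan t" by (rule prob_space_chan)
  have "tl_D \<alpha> t \<le> (\<integral>\<^sup>+h. ennreal 1 + ennreal (\<Sum>j=1..t. indicator {..\<alpha>} (prefix_normsq h j)) \<partial>chan t)"
    unfolding tl_D_def
  proof (intro nn_integral_mono)
    fix h
    have "ennreal (real (D_trained \<alpha> t h)) \<le> ennreal (1 + (\<Sum>j=1..t. indicator {..\<alpha>} (prefix_normsq h j)))"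
      by (intro ennreal_leI D_trained_le)
    then show "ennreal (real (D_trained \<alpha> t h)) \<le> ennreal 1 + ennreal (\<Sum>j=1..t. indicator {..\<alpha>} (prefix_normsq h j))"
      by (subst ennreal_plus[symmetric]) (auto simp: sum_nonneg simp del: ennreal_plus)
  qed
  also have "\<dots> = 1 + (\<integral>\<^sup>+h. ennreal (\<Sum>j=1..t. indicator {..\<alpha>} (prefix_normsq h j)) \<partial>chan t)"
    by (subst nn_integral_add)
       (auto simp: emeasure_space_1 intro!: measurable_compose[OF _ measurable_ennreal]
          borel_measurable_sum borel_measurable_indicator' measurable_prefix_normsq)
  also have "(\<integral>\<^sup>+h. ennreal (\<Sum>j=1..t. indicator {..\<alpha>} (prefix_normsq h j)) \<partial>chan t)
      = (\<integral>\<^sup>+x. ennreal (\<Sum>j=1..t. erlang_density (j - 1) 1 x * indicator {..\<alpha>} x) \<partial>lborel)"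
    by (rule nn_integral_sum_prefix_normsq) auto
  also have "\<dots> \<le> (\<integral>\<^sup>+x. indicator {0..\<alpha>} x \<partial>lborel)"
  proof (intro nn_integral_mono)
    fix x :: real
    show "ennreal (\<Sum>j=1..t. erlang_density (j - 1) 1 x * indicator {..\<alpha>} x) \<le> indicator {0..\<alpha>} x"
    proof (cases "0 \<le> x \<and> x \<le> \<alpha>")
      case True
      then show ?thesis
        using sum_erlang_density_le[of x t] by (simp add: sum.atLeast1_atMost_eq)
    next
      case False
      then show ?thesis by (auto simp: erlang_density_def)
    qed
  qed
  also have "\<dots> = ennreal \<alpha>" using assms by simp
  finally show ?thesis using assms by (simp add: ennreal_plus)
qed

lemma sum_erlang_density_bits_le:
  assumes "0 < \<alpha>"
  shows "(\<Sum>j=1..t. erlang_density (j - 1) 1 x *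
      ((2 * (real j + 1) * (real j + 6) + 1) * indicator {..\<alpha>} x + 2 * real j * overshoot_bits \<alpha> x))
    \<le> (2 * \<alpha>\<^sup>2 + 20 * \<alpha> + 29) * indicator {0..\<alpha>} x + 2 * (1 + 2 * \<alpha>) * overshoot_bits \<alpha> x"
proof (cases "0 \<le> x")
  case False
  then show ?thesis using assms by (auto simp: erlang_density_def overshoot_bits_def)
next
  case True
  define S0 where "S0 = (\<Sum>m<t. erlang_density m 1 x)"
  define S1 where "S1 = (\<Sum>m<t. real m * erlang_density m 1 x)"
  define S2 where "S2 = (\<Sum>m<t. real m * (real m - 1) * erlang_density m 1 x)"
  define v where "v = overshoot_bits \<alpha> x"
  define c :: real where "c = indicator {..\<alpha>} x"
  have S: "S0 \<le> 1" "S1 \<le> x" "S2 \<le> x\<^sup>2"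
    unfolding S0_def S1_def S2_def using True
    by (simp_all add: sum_erlang_density_le sum_erlang_density_moment1_le sum_erlang_density_moment2_le)
  \<comment> \<open>With \<open>m = j - 1\<close> the weight
    \<open>2 * (m + 2) * (m + 7) + 1\<close> equals \<open>2 * m * (m - 1) + 20 * m + 29\<close>,
    written in factorial powers to match the moment bounds.\<close>
  have "(\<Sum>j=1..t. erlang_density (j - 1) 1 x *
      ((2 * (real j + 1) * (real j + 6) + 1) * c + 2 * real j * v))
    = (\<Sum>m<t. c * (2 * (real m * (real m - 1) * erlang_density m 1 x)
        + 20 * (real m * erlang_density m 1 x) + 29 * erlang_density m 1 x)
        + 2 * v * (real m * erlang_density m 1 x + erlang_density m 1 x))"
    unfolding sum_atLeast1_shift by (intro sum.cong refl) (simp add: algebra_simps)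
  also have "\<dots> = c * (2 * S2 + 20 * S1 + 29 * S0) + 2 * v * (S1 + S0)"
    by (simp only: S0_def S1_def S2_def sum.distrib sum_distrib_left[symmetric])
  also have "\<dots> \<le> (2 * \<alpha>\<^sup>2 + 20 * \<alpha> + 29) * indicator {0..\<alpha>} x + 2 * (1 + 2 * \<alpha>) * v"
  proof (intro add_mono)
    show "c * (2 * S2 + 20 * S1 + 29 * S0) \<le> (2 * \<alpha>\<^sup>2 + 20 * \<alpha> + 29) * indicator {0..\<alpha>} x"
    proof (cases "x \<le> \<alpha>")
      case le: True
      then have "x\<^sup>2 \<le> \<alpha>\<^sup>2" using True by (intro power_mono)
      then have "2 * S2 + 20 * S1 + 29 * S0 \<le> 2 * \<alpha>\<^sup>2 + 20 * \<alpha> + 29"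
        using S le by linarith
      then show ?thesis using le True by (simp add: c_def)
    qed (simp add: c_def)
    show "2 * v * (S1 + S0) \<le> 2 * (1 + 2 * \<alpha>) * v"
    \<comment> \<open>Beyond \<open>2 * \<alpha>\<close> the overshoot vanishes; up to there
      \<open>S1 + S0\<close> is at most \<open>2 * \<alpha> + 1\<close>.\<close>
    proof (cases "x \<le> 2 * \<alpha>")
      case le: True
      have "2 * v * (S1 + S0) \<le> 2 * v * (1 + 2 * \<alpha>)"
        using S le overshoot_bits_nonneg[of \<alpha> x] by (intro mult_left_mono) (auto simp: v_def)
      then show ?thesis by (simp add: mult_ac)
    qed (simp add: v_def overshoot_bits_def)
  qed
  finally show ?thesis by (simp only: c_def v_def)
qed

lemma fr_D_le:
  assumes "0 < \<alpha>"
  shows "fr_D \<alpha> t \<le> ennreal (92 * (1 + \<alpha> ^ 3))"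
proof -
  interpret prob_space "chan t" by (rule prob_space_chan)
  define \<psi> where "\<psi> j x = (2 * (real j + 1) * (real j + 6) + 1) * indicator {..\<alpha>} x
     + 2 * real j * overshoot_bits \<alpha> x" for j x
  have [measurable]: "\<psi> j \<in> borel_measurable borel" for j
    unfolding \<psi>_def by measurable
  have \<psi>0: "0 \<le> \<psi> j x" for j x
    by (simp add: \<psi>_def overshoot_bits_nonneg)
  have "fr_D \<alpha> t \<le> (\<integral>\<^sup>+h. ennreal 12 + ennreal (\<Sum>j=1..t. \<psi> j (prefix_normsq h j)) \<partial>chan t)"
    unfolding fr_D_def
  proof (intro nn_integral_mono)
    fix h
    have "ennreal (real (D_bits \<alpha> t h)) \<le> ennreal (12 + (\<Sum>j=1..t. \<psi> j (prefix_normsq h j)))"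
      unfolding \<psi>_def using D_bits_le[OF assms] by (intro ennreal_leI)
    then show "ennreal (real (D_bits \<alpha> t h)) \<le> ennreal 12 + ennreal (\<Sum>j=1..t. \<psi> j (prefix_normsq h j))"
      by (subst ennreal_plus[symmetric]) (auto simp: sum_nonneg \<psi>0 simp del: ennreal_plus)
  qed
  also have "\<dots> = ennreal 12 + (\<integral>\<^sup>+h. ennreal (\<Sum>j=1..t. \<psi> j (prefix_normsq h j)) \<partial>chan t)"
    by (subst nn_integral_add)
       (auto simp: emeasure_space_1 intro!: measurable_compose[OF _ measurable_ennreal]
          borel_measurable_sum measurable_compose[OF measurable_prefix_normsq])
  also have "(\<integral>\<^sup>+h. ennreal (\<Sum>j=1..t. \<psi> j (prefix_normsq h j)) \<partial>chan t)
      = (\<integral>\<^sup>+x. ennreal (\<Sum>j=1..t. erlang_density (j - 1) 1 x * \<psi> j x) \<partial>lborel)"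
    by (rule nn_integral_sum_prefix_normsq) (auto simp: \<psi>0)
  also have "\<dots> \<le> (\<integral>\<^sup>+x. ennreal (2 * \<alpha>\<^sup>2 + 20 * \<alpha> + 29) * indicator {0..\<alpha>} x
      + ennreal (2 * (1 + 2 * \<alpha>)) * ennreal (overshoot_bits \<alpha> x) \<partial>lborel)"
  proof (intro nn_integral_mono)
    fix x
    have "ennreal (\<Sum>j=1..t. erlang_density (j - 1) 1 x * \<psi> j x)
       \<le> ennreal ((2 * \<alpha>\<^sup>2 + 20 * \<alpha> + 29) * indicator {0..\<alpha>} x
          + 2 * (1 + 2 * \<alpha>) * overshoot_bits \<alpha> x)"
      unfolding \<psi>_def by (intro ennreal_leI sum_erlang_density_bits_le assms)
    also have "\<dots> = ennreal (2 * \<alpha>\<^sup>2 + 20 * \<alpha> + 29) * indicator {0..\<alpha>} x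
      + ennreal (2 * (1 + 2 * \<alpha>)) * ennreal (overshoot_bits \<alpha> x)"
      using assms overshoot_bits_nonneg[of \<alpha> x]
      by (simp add: ennreal_plus ennreal_mult ennreal_indicator[symmetric] del: ennreal_indicator)
    finally show "ennreal (\<Sum>j=1..t. erlang_density (j - 1) 1 x * \<psi> j x)
       \<le> ennreal (2 * \<alpha>\<^sup>2 + 20 * \<alpha> + 29) * indicator {0..\<alpha>} x
      + ennreal (2 * (1 + 2 * \<alpha>)) * ennreal (overshoot_bits \<alpha> x)" .
  qed
  also have "\<dots> = ennreal (2 * \<alpha>\<^sup>2 + 20 * \<alpha> + 29) * ennreal \<alpha> + ennreal (2 * (1 + 2 * \<alpha>)) * ennreal (3 * \<alpha>)"
    using assms
    by (subst nn_integral_add) (simp_all add: nn_integral_cmult nn_integral_cmult_indicator nn_integral_overshoot_bits)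
  also have "ennreal 12 + \<dots> = ennreal (12 + ((2 * \<alpha>\<^sup>2 + 20 * \<alpha> + 29) * \<alpha> + 2 * (1 + 2 * \<alpha>) * (3 * \<alpha>)))"
    using assms by (simp add: ennreal_plus[symmetric] ennreal_mult[symmetric] del: ennreal_plus ennreal_numeral)
  also have "\<dots> \<le> ennreal (92 * (1 + \<alpha> ^ 3))"
  proof (rule ennreal_leI)
    \<comment> \<open>Up to 1 the lower powers are bounded by 1, beyond 1 by the cube.\<close>
    have \<alpha>1: "\<alpha> \<le> 1 + \<alpha> ^ 3" and \<alpha>2: "\<alpha>\<^sup>2 \<le> 1 + \<alpha> ^ 3"
    proof -
      have "0 < \<alpha> ^ 3" using assms by simp
      moreover have "\<alpha> \<le> \<alpha> ^ 3 \<and> \<alpha>\<^sup>2 \<le> \<alpha> ^ 3" if "1 \<le> \<alpha>"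
        using that power_increasing[of 1 3 \<alpha>] power_increasing[of 2 3 \<alpha>] by auto
      moreover have "\<alpha>\<^sup>2 \<le> 1" if "\<alpha> \<le> 1"
        using that assms by (simp add: power_le_one)
      ultimately show "\<alpha> \<le> 1 + \<alpha> ^ 3" "\<alpha>\<^sup>2 \<le> 1 + \<alpha> ^ 3"
        by (metis add_increasing add_increasing2 less_imp_le linear zero_le_one)+
    qed
    have "12 + ((2 * \<alpha>\<^sup>2 + 20 * \<alpha> + 29) * \<alpha> + 2 * (1 + 2 * \<alpha>) * (3 * \<alpha>))
       = 12 + 35 * \<alpha> + 32 * \<alpha>\<^sup>2 + 2 * \<alpha> ^ 3"
      by (simp add: algebra_simps power2_eq_square power3_eq_cube)
    \<comment> \<open>Replacing \<open>\<alpha>\<close> and its square by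
      \<open>1 + \<alpha> ^ 3\<close> gives \<open>79 + 69 * \<alpha> ^ 3\<close>, so the constant
      92 leaves room.\<close>
    also have "\<dots> \<le> 92 * (1 + \<alpha> ^ 3)"
    proof -
      have "12 + 35 * a + 32 * b + 2 * c \<le> 92 * (1 + c)"
        if "a \<le> 1 + c" "b \<le> 1 + c" "0 < c" for a b c :: real
        using that by (simp add: algebra_simps)
      then show ?thesis using \<alpha>1 \<alpha>2 zero_less_power[OF assms] .
    qed
    finally show "12 + ((2 * \<alpha>\<^sup>2 + 20 * \<alpha> + 29) * \<alpha> + 2 * (1 + 2 * \<alpha>) * (3 * \<alpha>)) \<le> 92 * (1 + \<alpha> ^ 3)" .
  qed
  finally show ?thesis by (simp add: add_left_mono)
qed

theorem theorem2:
  fixes t :: nat and \<alpha> :: real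
  assumes "t \<ge> 1" and "\<alpha> > 0"
  shows "outage t \<alpha> (D_beam \<alpha> t) = outage_F t \<alpha>
         \<and> outage_F t \<alpha> = measure (chan t) {h \<in> space (chan t). prefix_normsq h t < \<alpha>}
         \<and> tl_D \<alpha> t \<le> ennreal (1 + \<alpha>)
         \<and> fr_D \<alpha> t \<le> ennreal (92 * (1 + \<alpha> ^ 3))"
  using outage_D_beam[OF assms] tl_D_le[OF assms(2)] fr_D_le[OF assms(2)]
  by (simp add: outage_F_def)

end
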